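(* Suppose that $w_t\in\mathbb W=\{w\in\mathbb R^n:-\bar w\le w\le\bar w\}$ for all $t\ge 0$, that the true offset satisfies $\theta^a_t-\theta^a_{t-1}\in\mathcal P=\{\delta\in\mathbb R^p:K^\theta\delta\le l^\theta\}$ at all times, and that $\theta^a_t\in\Omega$ for all $t\ge0$. Then the Feasible Parameter Sets $\Theta_t$ obtained by the recursion in the context, along any trajectory of $x_{t+1}=Ax_t+Bu_t+E\theta^a_t+w_t$, are nonempty and contain the true offset at all times: $\Theta_t\ne\emptyset$ and $\theta^a_t\in\Theta_t$ for all $t\ge0$.
   Context: **System.** $x_{t+1}=Ax_t+Bu_t+E\theta^a_t+w_t$, with $x_t\in\mathbb R^n$, $u_t\in\mathbb R^m$, $\theta^a_t\in\mathbb R^p$, and known matrices $A$, $B$, $E\in\mathbb R^{n\times p}$. Vector inequalities are componentwise. $\mathcal P$ is a bounded polytope. $\Omega=\{\theta\in\mathbb R^p:\mathcal H^\theta_0\theta\le h^\theta_0\}$, $h^\theta_0\in\mathbb R^{r_0}$, is a known nonempty polytope containing zero in its interior. **Feasible Parameter Sets.** Let $\underline\nu,\bar\nu\in\mathbb R^n$ be the componentwise minimum and maximum of $E\nu$ over $\{\nu:K^\theta\nu\le l^\theta\}$. Set $\Theta_0=\Omega$. For $t\ge0$, given $\Theta_t=\{\theta\in\mathbb R^p:\mathcal H^\theta_t\theta\le h^\theta_t\}$ and the measurement $x_{t+1}$, set $\Theta_{t+1}=\{\theta\in\mathbb R^p:\mathcal H^\theta_{t+1}\theta\le h^\theta_{t+1}\}$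 with $$\mathcal H^\theta_{t+1}=\begin{bmatrix}\mathcal H^\theta_t \\ -E \\ E\end{bmatrix},\quad h^\theta_{t+1}=\begin{bmatrix}h^\theta_t+\Delta h^\theta_t \\ -x_{t+1}+Ax_t+Bu_t+\bar w-\underline\nu \\ x_{t+1}-Ax_t-Bu_t+\bar w+\bar\nu\end{bmatrix},$$ $$\Delta h^\theta_t=[\mathbf 0_{r_0}^\top,-\underline\nu^\top,\bar\nu^\top,\dots,-\underline\nu^\top,\bar\nu^\top]^\top,$$ where the block pair $(-\underline\nu,\bar\nu)$ appears $t$ times. *)

theory Defs
  imports "HOL-Analysis.Analysis"
begin

text \<open>
  Vector inequalities are the componentwise order of the library on \<^typ>\<open>real ^ 'n\<close>.
  The matrices \<open>H t\<close> of the recursion gain rows with \<open>t\<close>, so they are represented by the list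
  of their rows; \<open>index_list\<close> is an arbitrary enumeration of the index type, which fixes only the
  order of these rows.
\<close>

definition halfspaces :: "real ^ 'p ^ 'k \<Rightarrow> real ^ 'k \<Rightarrow> (real ^ 'p) set" where
  "halfspaces K l = {v. K *v v \<le> l}"

definition index_list :: "'k::finite list" where
  "index_list = (SOME xs. distinct xs \<and> set xs = UNIV)"

lemma distinct_index_list: "distinct (index_list :: 'k::finite list)"
  and set_index_list: "set (index_list :: 'k::finite list) = UNIV"
proof -
  have "\<exists>xs :: 'k list. distinct xs \<and> set xs = UNIV"
    using finite_distinct_list[of "UNIV :: 'k set"] by auto
  then have "distinct (index_list :: 'k list) \<and> set (index_list :: 'k list) = UNIV"
    unfolding index_list_def by (rule someI_ex)
  then show "distinct (index_list :: 'k list)" "set (index_list :: 'k list) = UNIV"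
    by auto
qed

lemma length_index_list: "length (index_list :: 'k::finite list) = CARD('k)"
  using distinct_card[OF distinct_index_list[where 'k = 'k]] by (simp add: set_index_list)

definition row_list :: "real ^ 'p ^ 'k \<Rightarrow> (real ^ 'p) list" where
  "row_list M = map (\<lambda>i. row i M) index_list"

definition entry_list :: "real ^ 'k \<Rightarrow> real list" where
  "entry_list v = map (\<lambda>i. v $ i) index_list"

definition list_halfspaces :: "(real ^ 'p) list \<Rightarrow> real list \<Rightarrow> (real ^ 'p) set" where
  "list_halfspaces H h = {v. list_all2 (\<lambda>a b. a \<bullet> v \<le> b) H h}"

lemma list_halfspaces_row_list:
  "list_halfspaces (row_list M) (entry_list b) = halfspaces M b"
  by (auto simp: list_halfspaces_def row_list_def entry_list_def halfspaces_def set_index_list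
      list.rel_map list_all2_same less_eq_vec_def matrix_vector_mul_component row_def)

definition comp_min :: "real ^ 'p ^ 'n \<Rightarrow> (real ^ 'p) set \<Rightarrow> real ^ 'n" where
  "comp_min E P = (\<chi> i. LEAST y. y \<in> (\<lambda>v. (E *v v) $ i) ` P)"

definition comp_max :: "real ^ 'p ^ 'n \<Rightarrow> (real ^ 'p) set \<Rightarrow> real ^ 'n" where
  "comp_max E P = (\<chi> i. GREATEST y. y \<in> (\<lambda>v. (E *v v) $ i) ` P)"

text \<open>\<open>relaxation H0 lo up t\<close> is the vector $\Delta h_t$, with \<open>CARD('r)\<close> leading zeros.\<close>

definition relaxation ::
  "real ^ 'p ^ 'r \<Rightarrow> real ^ 'n \<Rightarrow> real ^ 'n \<Rightarrow> nat \<Rightarrow> real list" where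
  "relaxation H0 lo up t =
     replicate CARD('r) 0 @ concat (replicate t (entry_list (- lo) @ entry_list up))"

primrec fps_lhs ::
  "real ^ 'p ^ 'r \<Rightarrow> real ^ 'p ^ 'n \<Rightarrow> nat \<Rightarrow> (real ^ 'p) list"
where
  "fps_lhs H0 E 0 = row_list H0"
| "fps_lhs H0 E (Suc t) = fps_lhs H0 E t @ row_list (- E) @ row_list E"

primrec fps_rhs ::
  "real ^ 'p ^ 'r \<Rightarrow> real ^ 'r \<Rightarrow>
   real ^ 'n ^ 'n \<Rightarrow> real ^ 'm ^ 'n \<Rightarrow> real ^ 'n \<Rightarrow> real ^ 'n \<Rightarrow> real ^ 'n \<Rightarrow>
   (nat \<Rightarrow> real ^ 'n) \<Rightarrow> (nat \<Rightarrow> real ^ 'm) \<Rightarrow> nat \<Rightarrow> real list"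
where
  "fps_rhs H0 h0 A B wbar lo up x u 0 = entry_list h0"
| "fps_rhs H0 h0 A B wbar lo up x u (Suc t) =
     map2 (+) (fps_rhs H0 h0 A B wbar lo up x u t) (relaxation H0 lo up t)
     @ entry_list (- x (Suc t) + A *v x t + B *v u t + wbar - lo)
     @ entry_list (x (Suc t) - A *v x t - B *v u t + wbar + up)"

definition feasible_parameter_set ::
  "real ^ 'p ^ 'r \<Rightarrow> real ^ 'r \<Rightarrow>
   real ^ 'n ^ 'n \<Rightarrow> real ^ 'm ^ 'n \<Rightarrow> real ^ 'p ^ 'n \<Rightarrow>
   real ^ 'n \<Rightarrow> real ^ 'n \<Rightarrow> real ^ 'n \<Rightarrow>
   (nat \<Rightarrow> real ^ 'n) \<Rightarrow> (nat \<Rightarrow> real ^ 'm) \<Rightarrow> nat \<Rightarrow> (real ^ 'p) set"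
where
  "feasible_parameter_set H0 h0 A B E wbar lo up x u t =
     list_halfspaces (fps_lhs H0 E t) (fps_rhs H0 h0 A B wbar lo up x u t)"

lemma feasible_parameter_set_0:
  "feasible_parameter_set H0 h0 A B E wbar lo up x u 0 = halfspaces H0 h0"
  by (simp add: feasible_parameter_set_def list_halfspaces_row_list)

end

theory Submission
  imports Defs
begin

text \<open>
  Write \<open>\<delta> = \<theta> (t+1) - \<theta> t \<in> P\<close>, so that \<open>lo \<le> E \<delta> \<le> up\<close>. Every measurement block that holds at
  \<open>\<theta> t\<close> holds at \<open>\<theta> (t+1)\<close> once its right-hand side is relaxed by \<open>(-lo, up)\<close>; the new block
  holds because \<open>x (t+1) - A x - B u = E \<theta> (t+1) - E \<delta> + w\<close> with \<open>-wbar \<le> w \<le> wbar\<close>. The leading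
  rows are never relaxed, so there the induction hypothesis is useless and \<open>\<theta> (t+1) \<in> \<Omega>\<close> takes
  its place; the induction therefore runs over the measurement blocks alone.
\<close>

text \<open>\<open>LEAST\<close> and \<open>GREATEST\<close> over the reals are informative only
  when the extremum is attained. Compactness of \<open>P\<close> gives this: each coordinate of
  \<open>E *v v\<close> is continuous in \<open>v\<close>, so its image of \<open>P\<close> is
  compact, and it is nonempty because it contains the value at the given point.\<close>

lemma comp_min_max_bounds:
  fixes E :: "real ^ 'p ^ 'n"
  assumes "compact P" "v \<in> P"
  shows "comp_min E P \<le> E *v v" "E *v v \<le> comp_max E P"
proof -
  have "(comp_min E P) $ i \<le> (E *v v) $ i \<and> (E *v v) $ i \<le> (comp_max E P) $ i" for i
  proof -
    let ?S = "(\<lambda>v. (E *v v) $ i) ` P"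
    have "continuous_on P (\<lambda>v. (E *v v) $ i)"
      by (intro continuous_intros linear_continuous_on) (simp add: matrix_vector_mul_bounded_linear)
    then have S: "compact ?S" "?S \<noteq> {}"
      using assms by (auto intro: compact_continuous_image)
    obtain a where a: "a \<in> ?S" "\<forall>y\<in>?S. a \<le> y"
      using compact_attains_inf[OF S] by blast
    obtain b where b: "b \<in> ?S" "\<forall>y\<in>?S. y \<le> b"
      using compact_attains_sup[OF S] by blast
    have "(LEAST y. y \<in> ?S) = a"
      using a by (intro Least_equality) auto
    moreover have "(GREATEST y. y \<in> ?S) = b"
      using b by (intro Greatest_equality) auto
    ultimately show ?thesis
      using a(2) b(2) assms(2) by (simp add: comp_min_def comp_max_def)
  qed
  then show "comp_min E P \<le> E *v v" "E *v v \<le> comp_max E P"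
    by (auto simp: less_eq_vec_def)
qed

lemma list_halfspaces_append:
  assumes "v \<in> list_halfspaces H h" "v \<in> list_halfspaces H' h'"
  shows "v \<in> list_halfspaces (H @ H') (h @ h')"
  using assms by (auto simp: list_halfspaces_def intro: list_all2_appendI)

lemma list_halfspaces_concat_replicate:
  assumes "v \<in> list_halfspaces H h"
  shows "v \<in> list_halfspaces (concat (replicate t H)) (concat (replicate t h))"
proof (induction t)
  case 0
  then show ?case by (simp add: list_halfspaces_def)
next
  case (Suc t)
  then show ?case using assms by (simp add: list_halfspaces_append)
qed

text \<open>Rows act linearly, so the bounds add up row by row; \<open>list_all2\<close> forces
  equal lengths, hence \<open>map2\<close> truncates nothing. With \<open>d\<close> the parameter
  increment, this is the relaxation step.\<close>

lemma list_halfspaces_add: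
  assumes "v \<in> list_halfspaces H h" "d \<in> list_halfspaces H c"
  shows "v + d \<in> list_halfspaces H (map2 (+) h c)"
  using assms
  by (auto simp: list_halfspaces_def list_all2_conv_all_nth inner_add_right intro: add_mono)

lemma list_halfspaces_two_sided:
  fixes E :: "real ^ 'p ^ 'n"
  shows "v \<in> list_halfspaces (row_list (- E) @ row_list E) (entry_list a @ entry_list b)
    \<longleftrightarrow> - (E *v v) \<le> a \<and> E *v v \<le> b"
proof -
  have "v \<in> list_halfspaces (row_list (- E) @ row_list E) (entry_list a @ entry_list b)
    \<longleftrightarrow> v \<in> list_halfspaces (row_list (- E)) (entry_list a) \<and>
      v \<in> list_halfspaces (row_list E) (entry_list b)"
    \<comment> \<open>The conjunction splits at the append because rows and entries are listed along
      the same \<open>index_list\<close>, so the two front parts have equal length.\<close>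
    by (simp add: list_halfspaces_def list_all2_append row_list_def entry_list_def)
  moreover have "- E *v v = - (E *v v)"
    by (simp add: vec_eq_iff matrix_vector_mult_def sum_negf)
  ultimately show ?thesis
    by (simp add: list_halfspaces_row_list halfspaces_def)
qed

lemma concat_replicate_Suc: "concat (replicate (Suc t) xs) = concat (replicate t xs) @ xs"
  by (induction t) simp_all

text \<open>Separates the rows of \<open>H0\<close> from the t identical measurement blocks. The
  recursion appends at the end while \<open>replicate\<close> unfolds at the front, hence the use of
  \<open>concat_replicate_Suc\<close>.\<close>

lemma fps_lhs_eq:
  "fps_lhs H0 E t = row_list H0 @ concat (replicate t (row_list (- E) @ row_list E))"
proof (induction t)
  case (Suc t)
  then show ?case by (simp add: concat_replicate_Suc del: replicate_Suc)
qed simp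

lemma map2_add_replicate_zero:
  fixes h :: "real list"
  shows "map2 (+) h (replicate (length h) 0) = h"
  by (induction h) simp_all

text \<open>The leading zeros of \<open>relaxation\<close> are exactly as many as the entries of
  \<open>h0\<close>, so zipping splits at that point and leaves \<open>h0\<close> unchanged.\<close>

lemma fps_rhs_relaxed:
  fixes h0 :: "real ^ 'r" and H0 :: "real ^ 'p ^ 'r"
  shows "map2 (+) (entry_list h0 @ R) (relaxation H0 lo up t) =
    entry_list h0 @ map2 (+) R (concat (replicate t (entry_list (- lo) @ entry_list up)))"
proof -
  have "length (entry_list h0) = CARD('r)"
    by (simp add: entry_list_def length_index_list)
  with map2_add_replicate_zero[of "entry_list h0"] show ?thesis
    by (simp add: relaxation_def)
qed

theorem proposition1:
  fixes A :: "real ^ 'n ^ 'n"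
    and B :: "real ^ 'm ^ 'n"
    and E :: "real ^ 'p ^ 'n"
    and K :: "real ^ 'p ^ 'k" and l :: "real ^ 'k"
    and H0 :: "real ^ 'p ^ 'r" and h0 :: "real ^ 'r"
    and wbar lo up :: "real ^ 'n"
    and P \<Omega> :: "(real ^ 'p) set" and W :: "(real ^ 'n) set"
    and x w :: "nat \<Rightarrow> real ^ 'n" and u :: "nat \<Rightarrow> real ^ 'm"
    and \<theta> :: "nat \<Rightarrow> real ^ 'p"
    and \<Theta> :: "nat \<Rightarrow> (real ^ 'p) set"
  assumes P: "P = halfspaces K l" "polytope P"
    and \<Omega>: "\<Omega> = halfspaces H0 h0" "polytope \<Omega>" "\<Omega> \<noteq> {}" "0 \<in> interior \<Omega>"
    and W: "W = {v. - wbar \<le> v \<and> v \<le> wbar}"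
    and lo: "lo = comp_min E P"
    and up: "up = comp_max E P"
    and \<Theta>: "\<Theta> = feasible_parameter_set H0 h0 A B E wbar lo up x u"
    and dynamics: "\<And>t. x (Suc t) = A *v x t + B *v u t + E *v \<theta> t + w t"
    and disturbance: "\<And>t. w t \<in> W"
    and variation: "\<And>t. \<theta> (Suc t) - \<theta> t \<in> P"
    and offset: "\<And>t. \<theta> t \<in> \<Omega>"
  shows "\<forall>t. \<Theta> t \<noteq> {} \<and> \<theta> t \<in> \<Theta> t"
proof -
  let ?M = "row_list (- E) @ row_list E"
  have "compact P"
    using P(2) by (rule polytope_imp_compact)
  then have bounds: "lo \<le> E *v d" "E *v d \<le> up" if "d \<in> P" for d
    using comp_min_max_bounds that by (auto simp: lo up)
  \<comment> \<open>\<open>R\<close> collects the right-hand sides of the t measurement blocks; it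
    is empty at time 0.\<close>
  have blocks: "\<exists>R. fps_rhs H0 h0 A B wbar lo up x u t = entry_list h0 @ R \<and>
      \<theta> t \<in> list_halfspaces (concat (replicate t ?M)) R" for t
  proof (induction t)
    case 0
    show ?case by (simp add: list_halfspaces_def)
  next
    case (Suc t)
    then obtain R where R: "fps_rhs H0 h0 A B wbar lo up x u t = entry_list h0 @ R"
      "\<theta> t \<in> list_halfspaces (concat (replicate t ?M)) R"
      by blast
    define \<delta> where "\<delta> = \<theta> (Suc t) - \<theta> t"
    have E\<theta>: "E *v \<theta> (Suc t) = E *v \<theta> t + E *v \<delta>"
      by (simp add: \<delta>_def flip: matrix_vector_right_distrib)
    have \<delta>: "lo \<le> E *v \<delta>" "E *v \<delta> \<le> up"
      using bounds variation by (auto simp: \<delta>_def)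
    have w: "- wbar \<le> w t" "w t \<le> wbar"
      using disturbance[of t] by (auto simp: W)
    let ?C = "entry_list (- lo) @ entry_list up"
    let ?N = "entry_list (- x (Suc t) + A *v x t + B *v u t + wbar - lo)
      @ entry_list (x (Suc t) - A *v x t - B *v u t + wbar + up)"
    have "\<delta> \<in> list_halfspaces ?M ?C"
      using \<delta> by (simp add: list_halfspaces_two_sided)
    with R(2) have "\<theta> t + \<delta> \<in> list_halfspaces (concat (replicate t ?M))
        (map2 (+) R (concat (replicate t ?C)))"
      by (intro list_halfspaces_add list_halfspaces_concat_replicate)
    then have old: "\<theta> (Suc t) \<in> list_halfspaces (concat (replicate t ?M))
        (map2 (+) R (concat (replicate t ?C)))"
      by (simp add: \<delta>_def)
    \<comment> \<open>The measurement involves \<open>\<theta> t\<close>, but the block is tested at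
      \<open>\<theta> (Suc t)\<close>. After substituting the dynamics,
      \<open>E *v \<theta> t\<close> cancels and \<open>lo + w t \<le> E *v \<delta> + wbar\<close>
      remains; the upper side reduces to \<open>E *v \<delta> - wbar \<le> up + w t\<close>.\<close>
    have "- (E *v \<theta> (Suc t)) \<le> - x (Suc t) + A *v x t + B *v u t + wbar - lo"
      using add_mono[OF \<delta>(1) w(2)] by (simp add: dynamics E\<theta> algebra_simps)
    moreover have "E *v \<theta> (Suc t) \<le> x (Suc t) - A *v x t - B *v u t + wbar + up"
      using add_mono[OF \<delta>(2) w(1)] by (simp add: dynamics E\<theta> algebra_simps)
    ultimately have "\<theta> (Suc t) \<in> list_halfspaces ?M ?N"
      by (simp only: list_halfspaces_two_sided)
    with old have "\<theta> (Suc t) \<in> list_halfspaces (concat (replicate t ?M) @ ?M)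
        (map2 (+) R (concat (replicate t ?C)) @ ?N)"
      by (rule list_halfspaces_append)
    \<comment> \<open>The relaxation at time t covers just the t older blocks; the new block
      \<open>?N\<close> already contains its own \<open>lo\<close> and \<open>up\<close>.\<close>
    moreover have "fps_rhs H0 h0 A B wbar lo up x u (Suc t) =
        entry_list h0 @ map2 (+) R (concat (replicate t ?C)) @ ?N"
      by (simp add: R(1) fps_rhs_relaxed)
    ultimately show ?case by (metis concat_replicate_Suc)
  qed
  have "\<theta> t \<in> \<Theta> t" for t
  proof -
    obtain R where R: "fps_rhs H0 h0 A B wbar lo up x u t = entry_list h0 @ R"
      "\<theta> t \<in> list_halfspaces (concat (replicate t ?M)) R"
      using blocks by blast
    have "\<theta> t \<in> list_halfspaces (row_list H0) (entry_list h0)"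
      using offset[of t] by (simp add: \<Omega>(1) list_halfspaces_row_list)
    from list_halfspaces_append[OF this R(2)] show ?thesis
      by (simp add: \<Theta> feasible_parameter_set_def R(1) fps_lhs_eq)
  qed
  then show ?thesis by blast
qed

end
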